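(* Let $|G\rangle$ be the weighted graph state of a weighted graph $G=(V,E,\Theta)$ on $n$ vertices, let $\mathscr{A}=\{A_1,\dots,A_m\}$ be an independence cover of $V$, let $\mathbf h=\{h(k)\}_{k\in[n]}$ be positive integers, let $N\ge1$ be an integer and $\beta\in(0,1]$. Let $\bar\Omega(\mathscr{A})_{\mathbf h}=\frac1m\sum_{l=1}^m\bar P_l$ be the test operator defined in the context. Then: (1) the state $|G\rangle^{\otimes(N+1)}$ passes the $N$-random sampling test of $\bar\Omega(\mathscr{A})_{\mathbf h}$ with probability $1$; (2) when the $N$-random sampling test of $\bar\Omega(\mathscr{A})_{\mathbf h}$ is passed, the resultant state $\sigma$ satisfies, with significance level $\beta$, $$\langle G|\sigma|G\rangle\ \ge\ 1-\frac{m(1-\beta)\max_{k\in[n]}h(k)}{N\beta}.$$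
   Context: **Weighted graph states.** A weighted graph $G=(V,E,\Theta)$ consists of a finite vertex set $V=[n]=\{1,\dots,n\}$, a set $E$ of edges, and real weights $\Theta=\{\theta_{jk}\}_{j<k}$, with $\theta_{jk}=0$ if $(j,k)\notin E$; put $\theta_{kj}=\theta_{jk}$. One qubit $\mathbb{C}^2$ is placed on each vertex. With $|+\rangle=(|0\rangle+|1\rangle)/\sqrt2$ and $\Lambda_{jk}(\theta)=|0\rangle\langle 0|_j\otimes I_k+|1\rangle\langle 1|_j\otimes(|0\rangle\langle 0|_k+e^{i\theta}|1\rangle\langle1|_k)$, the weighted graph state is $|G\rangle=\big[\prod_{(j,k)\in E}\Lambda_{jk}(\theta_{jk})\big]|+\rangle^{\otimes n}$. **Independence cover.** A subset of $V$ is independent if no two of its vertices are joined by an edge. An independence cover $\mathscr{A}=\{A_1,\dots,A_m\}$ is a set of independent sets with $\bigcup_l A_l=V$; throughout, the $A_l$ are nonempty and pairwise disjoint. $A_l^c=V\setminus A_l$. **Test operator.** For real $\alpha$ put $|\alpha\rangle=\frac1{\sqrt2}(|0\rangle+e^{i\alpha}|1\rangle)$. For $k\in A_l$, let $C_k\subset A_l^c$ be the set of neighbours of $k$, and for $\mathbf z=(z_j)_{j\in A_l^c}\in\{0,1\}^{A_l^c}$ put $\alpha_k(\mathbf z)=\sum_{j\in C_k}\theta_{jk}z_j$. Define $$Q_k=\sum_{\mathbf z\in\{0,1\}^{A_l^c}}|\alpha_k(\mathbf z)\rangle\langle\alpha_k(\mathbf z)|_k\otimes|\mathbf z\rangle\langle\mathbf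 z|_{A_l^c}$$ (acting as the identity on $A_l\setminus\{k\}$), and $$\bar P_l=\prod_{k\in A_l}\left(\frac1{h(k)}Q_k+\frac{h(k)-1}{h(k)}I\right),\qquad \bar\Omega(\mathscr{A})_{\mathbf h}=\frac1m\sum_{l=1}^m\bar P_l.$$ **$N$-random sampling test of an operator $0\le\Omega\le I$.** Let $\rho$ be an arbitrary state (no i.i.d. assumption) on $N+1$ copies of the $n$-qubit system. Choose $N$ of the $N+1$ copies uniformly at random, apply the two-outcome POVM $\{\Omega,I-\Omega\}$ to each of them, and accept (the test is passed) iff all $N$ outcomes correspond to $\Omega$. When the test is passed, the resultant state $\sigma$ is the state of the remaining copy conditional on acceptance. Explicitly, writing $\Omega^{(i)}$ for the operator acting as $\Omega$ on every copy except the $i$-th and as $I$ on the $i$-th, the passing probability is $p(\rho)=\frac1{N+1}\sum_{i=1}^{N+1}\mathrm{Tr}[\Omega^{(i)}\rho]$, and $\mathrm{Tr}[\sigma X]=\frac{1}{p(\rho)(N+1)}\sum_{i=1}^{N+1}\mathrm{Tr}[\Omega^{(i)}X_i\,\rho]$ for every operator $X$ on a single copy, where $X_i$ is $X$ acting on the $i$-th copy. **Significance level.** A statement about $\sigma$ holds "with significance level $\beta$" if it holds for every $\rho$ with passing probability $p(\rho)\ge\beta$. *)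

theory Defs
  imports "HOL-Analysis.Analysis"
begin

section \<open>Linear algebra over the complex numbers\<close>

text \<open>
  A finite type \<open>'a\<close> labels the computational basis of the space \<open>complex ^ 'a\<close>.  A qubit is labelled
  by \<open>bool\<close>, with \<open>False\<close> and \<open>True\<close> in the roles of 0 and 1.  A tensor product of
  copies of \<open>complex ^ 'a\<close>, one for each element of \<open>'i\<close>, is labelled by \<open>'i \<Rightarrow> 'a\<close>.
\<close>

type_synonym 'a ket = "complex ^ 'a"
type_synonym 'a oper = "complex ^ 'a ^ 'a"

definition ket :: "'a::finite \<Rightarrow> 'a ket" where
  "ket a = axis a 1"

definition braket :: "'a::finite ket \<Rightarrow> 'a ket \<Rightarrow> complex" where
  "braket u v = (\<Sum>a\<in>UNIV. cnj (u $ a) * v $ a)"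

definition ketbra :: "'a::finite ket \<Rightarrow> 'a ket \<Rightarrow> 'a oper" where
  "ketbra u v = (\<chi> a b. u $ a * cnj (v $ b))"

abbreviation proj :: "'a::finite ket \<Rightarrow> 'a oper" where
  "proj u \<equiv> ketbra u u"

text \<open>Over the complex numbers, a real nonnegative quadratic form already forces \<open>M\<close> to be Hermitian.\<close>

definition positive_op :: "'a::finite oper \<Rightarrow> bool" where
  "positive_op M \<longleftrightarrow> (\<forall>v. braket v (M *v v) \<in> \<real> \<and> 0 \<le> Re (braket v (M *v v)))"

definition density_op :: "'a::finite oper \<Rightarrow> bool" where
  "density_op \<rho> \<longleftrightarrow> positive_op \<rho> \<and> trace \<rho> = 1"

definition tensor_ket :: "('i::finite \<Rightarrow> 'a::finite ket) \<Rightarrow> ('i \<Rightarrow> 'a) ket" where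
  "tensor_ket u = (\<chi> x. \<Prod>i\<in>UNIV. u i $ x i)"

definition tensor_op :: "('i::finite \<Rightarrow> 'a::finite oper) \<Rightarrow> ('i \<Rightarrow> 'a) oper" where
  "tensor_op M = (\<chi> x y. \<Prod>i\<in>UNIV. M i $ x i $ y i)"

definition on_site :: "'i::finite \<Rightarrow> 'a::finite oper \<Rightarrow> ('i \<Rightarrow> 'a) oper" where
  "on_site i M = tensor_op (\<lambda>j. if j = i then M else mat 1)"

fun op_prod :: "'a::finite oper list \<Rightarrow> 'a oper" where
  "op_prod [] = mat 1"
| "op_prod (M # Ms) = M ** op_prod Ms"


section \<open>Weighted graph states\<close>

text \<open>
  The vertices are the elements of a finite linearly ordered type.  An edge is given
  as the pair \<open>(j, k)\<close> of its endpoints with \<open>j < k\<close>; an edge may carry weight zero.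
  The diagonal values \<open>\<theta> j j\<close> are never used.
\<close>

definition weighted_graph ::
  "('v::{finite,linorder} \<times> 'v) set \<Rightarrow> ('v \<Rightarrow> 'v \<Rightarrow> real) \<Rightarrow> bool" where
  "weighted_graph E \<theta> \<longleftrightarrow>
     (\<forall>(j, k)\<in>E. j < k) \<and>
     (\<forall>j k. \<theta> k j = \<theta> j k) \<and>
     (\<forall>j k. j < k \<and> (j, k) \<notin> E \<longrightarrow> \<theta> j k = 0)"

definition adjacent :: "('v \<times> 'v) set \<Rightarrow> 'v \<Rightarrow> 'v \<Rightarrow> bool" where
  "adjacent E j k \<longleftrightarrow> (j, k) \<in> E \<or> (k, j) \<in> E"

definition independent_vertices :: "('v \<times> 'v) set \<Rightarrow> 'v set \<Rightarrow> bool" where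
  "independent_vertices E A \<longleftrightarrow> (\<forall>j\<in>A. \<forall>k\<in>A. \<not> adjacent E j k)"

text \<open>\<open>partition_on\<close> says that the members are nonempty, pairwise disjoint and cover all vertices.\<close>

definition independence_cover :: "('v \<times> 'v) set \<Rightarrow> 'v set set \<Rightarrow> bool" where
  "independence_cover E \<A> \<longleftrightarrow> partition_on UNIV \<A> \<and> (\<forall>A\<in>\<A>. independent_vertices E A)"

definition phase_ket :: "real \<Rightarrow> bool ket" where
  "phase_ket \<alpha> = (1 / sqrt 2) *\<^sub>R (ket False + cis \<alpha> *s ket True)"

definition plus_ket :: "bool ket" where
  "plus_ket = (1 / sqrt 2) *\<^sub>R (ket False + ket True)"

definition controlled_phase :: "'v::finite \<Rightarrow> 'v \<Rightarrow> real \<Rightarrow> ('v \<Rightarrow> bool) oper" where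
  "controlled_phase j k t =
     on_site j (proj (ket False)) +
     on_site j (proj (ket True)) **
       on_site k (proj (ket False) + ketbra (cis t *s ket True) (ket True))"

text \<open>All factors of the following product, and of \<open>cover_op\<close> below, commute;
  the order of the vertices is used only to write the product as a list.\<close>

definition edge_list :: "('v::{finite,linorder} \<times> 'v) set \<Rightarrow> ('v \<times> 'v) list" where
  "edge_list E =
     filter (\<lambda>e. e \<in> E) (List.product (sorted_list_of_set UNIV) (sorted_list_of_set UNIV))"

definition graph_state ::
  "('v::{finite,linorder} \<times> 'v) set \<Rightarrow> ('v \<Rightarrow> 'v \<Rightarrow> real) \<Rightarrow> ('v \<Rightarrow> bool) ket" where
  "graph_state E \<theta> =
     op_prod (map (\<lambda>(j, k). controlled_phase j k (\<theta> j k)) (edge_list E))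
       *v tensor_ket (\<lambda>_. plus_ket)"


section \<open>Test operator\<close>

definition phase_angle ::
  "('v::finite \<times> 'v) set \<Rightarrow> ('v \<Rightarrow> 'v \<Rightarrow> real) \<Rightarrow> 'v set \<Rightarrow> 'v \<Rightarrow> ('v \<Rightarrow> bool) \<Rightarrow> real" where
  "phase_angle E \<theta> A k z = (\<Sum>j | j \<in> - A \<and> adjacent E j k. \<theta> j k * of_bool (z j))"

text \<open>Bit strings on \<open>- A\<close> are the extensional functions, so that each one is counted once.\<close>

definition Q_op ::
  "('v::finite \<times> 'v) set \<Rightarrow> ('v \<Rightarrow> 'v \<Rightarrow> real) \<Rightarrow> 'v set \<Rightarrow> 'v \<Rightarrow> ('v \<Rightarrow> bool) oper" where
  "Q_op E \<theta> A k =
     (\<Sum>z \<in> (- A) \<rightarrow>\<^sub>E UNIV.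
        tensor_op (\<lambda>v. if v = k then proj (phase_ket (phase_angle E \<theta> A k z))
                       else if v \<in> - A then proj (ket (z v))
                       else mat 1))"

definition cover_op ::
  "('v::{finite,linorder} \<times> 'v) set \<Rightarrow> ('v \<Rightarrow> 'v \<Rightarrow> real) \<Rightarrow> ('v \<Rightarrow> nat) \<Rightarrow> 'v set
     \<Rightarrow> ('v \<Rightarrow> bool) oper" where
  "cover_op E \<theta> h A =
     op_prod (map (\<lambda>k. (1 / real (h k)) *\<^sub>R Q_op E \<theta> A k + ((real (h k) - 1) / real (h k)) *\<^sub>R mat 1)
                  (sorted_list_of_set A))"

definition test_op ::
  "('v::{finite,linorder} \<times> 'v) set \<Rightarrow> ('v \<Rightarrow> 'v \<Rightarrow> real) \<Rightarrow> 'v set set \<Rightarrow> ('v \<Rightarrow> nat)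
     \<Rightarrow> ('v \<Rightarrow> bool) oper" where
  "test_op E \<theta> \<A> h = (1 / real (card \<A>)) *\<^sub>R (\<Sum>A\<in>\<A>. cover_op E \<theta> h A)"


section \<open>Random sampling test\<close>

text \<open>The copies are labelled by a finite type \<open>'c\<close>, so \<open>CARD('c)\<close> stands for \<open>N + 1\<close>.\<close>

definition all_but :: "'c::finite \<Rightarrow> 'a::finite oper \<Rightarrow> ('c \<Rightarrow> 'a) oper" where
  "all_but i \<Omega> = tensor_op (\<lambda>j. if j = i then mat 1 else \<Omega>)"

text \<open>For \<open>0 \<le> \<Omega> \<le> I\<close> and a state \<open>\<rho>\<close> all the traces are real.\<close>

definition pass_prob :: "'a::finite oper \<Rightarrow> ('c::finite \<Rightarrow> 'a) oper \<Rightarrow> real" where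
  "pass_prob \<Omega> \<rho> = (\<Sum>i\<in>UNIV. Re (trace (all_but i \<Omega> ** \<rho>))) / real CARD('c)"

definition resultant_state ::
  "'a::finite oper \<Rightarrow> ('c::finite \<Rightarrow> 'a) oper \<Rightarrow> 'a oper \<Rightarrow> bool" where
  "resultant_state \<Omega> \<rho> \<sigma> \<longleftrightarrow>
     (\<forall>X. trace (\<sigma> ** X) =
          (\<Sum>i\<in>UNIV. trace (all_but i \<Omega> ** on_site i X ** \<rho>))
            / complex_of_real (pass_prob \<Omega> \<rho> * real CARD('c)))"

text \<open>The functional on the right-hand side is linear in \<open>X\<close>, so exactly one \<open>\<sigma>\<close> represents it.\<close>

lemma on_site_expand:
  fixes X :: "'a::finite oper" and i :: "'i::finite"
  shows "on_site i X $ x $ y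
    = (\<Sum>a\<in>UNIV. \<Sum>b\<in>UNIV. X $ a $ b * on_site i (ketbra (ket a) (ket b)) $ x $ y)"
proof -
  define r where "r = (\<Prod>j\<in>UNIV - {i}. (mat 1 :: 'a oper) $ x j $ y j)"
  have site: "on_site i Y $ x $ y = Y $ x i $ y i * r" for Y :: "'a oper"
  proof -
    have "on_site i Y $ x $ y = (\<Prod>j\<in>UNIV. (if j = i then Y else mat 1) $ x j $ y j)"
      by (simp add: on_site_def tensor_op_def)
    also have "\<dots> = Y $ x i $ y i * (\<Prod>j\<in>UNIV - {i}. (if j = i then Y else mat 1) $ x j $ y j)"
      by (subst prod.remove[of UNIV i]) simp_all
    also have "(\<Prod>j\<in>UNIV - {i}. (if j = i then Y else mat 1) $ x j $ y j) = r"
      unfolding r_def by (rule prod.cong) auto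
    finally show ?thesis .
  qed
  have "X $ x i $ y i = (\<Sum>a\<in>UNIV. \<Sum>b\<in>UNIV. X $ a $ b * ketbra (ket a) (ket b) $ x i $ y i)"
  proof -
    have "(\<Sum>a\<in>UNIV. \<Sum>b\<in>UNIV. X $ a $ b * ketbra (ket a) (ket b) $ x i $ y i)
      = (\<Sum>a\<in>UNIV. \<Sum>b\<in>UNIV. if b = y i then (if a = x i then X $ a $ b else 0) else 0)"
      by (intro sum.cong refl) (auto simp: ketbra_def ket_def axis_def)
    then show ?thesis by simp
  qed
  then have "X $ x i $ y i * r
    = (\<Sum>a\<in>UNIV. \<Sum>b\<in>UNIV. X $ a $ b * ketbra (ket a) (ket b) $ x i $ y i) * r"
    by simp
  then show ?thesis
    unfolding site by (simp add: sum_distrib_right mult.assoc)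
qed

lemma trace_mult_sum:
  fixes M X :: "'a::finite oper"
  shows "trace (M ** X) = (\<Sum>a\<in>UNIV. \<Sum>b\<in>UNIV. X $ a $ b * M $ b $ a)"
  unfolding trace_def matrix_matrix_mult_def
  by (subst sum.swap) (simp add: mult.commute)

lemma trace_mult_ketbra:
  fixes M :: "'a::finite oper"
  shows "trace (M ** ketbra (ket a) (ket b)) = M $ b $ a"
proof -
  have "trace (M ** ketbra (ket a) (ket b))
    = (\<Sum>c\<in>UNIV. \<Sum>d\<in>UNIV. if d = b then (if c = a then M $ d $ c else 0) else 0)"
    unfolding trace_mult_sum
    by (intro sum.cong refl) (auto simp: ketbra_def ket_def axis_def)
  then show ?thesis by simp
qed

lemma ex1_resultant_state:
  fixes \<Omega> :: "'a::finite oper" and \<rho> :: "('c::finite \<Rightarrow> 'a) oper"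
  shows "\<exists>!\<sigma>. resultant_state \<Omega> \<rho> \<sigma>"
proof -
  define c where "c = complex_of_real (pass_prob \<Omega> \<rho> * real CARD('c))"
  define F where "F X = (\<Sum>i\<in>UNIV. trace (all_but i \<Omega> ** on_site i X ** \<rho>)) / c" for X
  let ?U = "\<lambda>a b. ketbra (ket a) (ket b) :: 'a oper"
  have site: "trace (all_but i \<Omega> ** on_site i X ** \<rho>)
      = (\<Sum>a\<in>UNIV. \<Sum>b\<in>UNIV. X $ a $ b * trace (all_but i \<Omega> ** on_site i (?U a b) ** \<rho>))"
    for X and i :: 'c
  proof -
    define R where "R = \<rho> ** all_but i \<Omega>"
    have R: "trace (all_but i \<Omega> ** Y ** \<rho>) = (\<Sum>x\<in>UNIV. \<Sum>y\<in>UNIV. Y $ x $ y * R $ y $ x)" for Y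
      unfolding trace_mult_sum[symmetric] R_def
      by (metis trace_mul_sym matrix_mul_assoc)
    have "(\<Sum>x\<in>UNIV. \<Sum>y\<in>UNIV. on_site i X $ x $ y * R $ y $ x)
      = (\<Sum>x\<in>UNIV. \<Sum>y\<in>UNIV. \<Sum>a\<in>UNIV. \<Sum>b\<in>UNIV.
           X $ a $ b * (on_site i (?U a b) $ x $ y * R $ y $ x))"
      by (subst on_site_expand) (simp add: sum_distrib_right mult.assoc)
    also have "\<dots> = (\<Sum>x\<in>UNIV. \<Sum>a\<in>UNIV. \<Sum>b\<in>UNIV. \<Sum>y\<in>UNIV.
           X $ a $ b * (on_site i (?U a b) $ x $ y * R $ y $ x))"
      by (rule sum.cong[OF refl], subst sum.swap, rule sum.cong[OF refl], rule sum.swap)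
    also have "\<dots> = (\<Sum>a\<in>UNIV. \<Sum>b\<in>UNIV. \<Sum>x\<in>UNIV. \<Sum>y\<in>UNIV.
           X $ a $ b * (on_site i (?U a b) $ x $ y * R $ y $ x))"
      by (subst sum.swap, rule sum.cong[OF refl], rule sum.swap)
    finally show ?thesis
      unfolding R by (simp add: sum_distrib_left)
  qed
  have F: "F X = (\<Sum>a\<in>UNIV. \<Sum>b\<in>UNIV. X $ a $ b * F (?U a b))" for X
  proof -
    have "(\<Sum>i\<in>UNIV. trace (all_but i \<Omega> ** on_site i X ** \<rho>))
      = (\<Sum>a\<in>UNIV. \<Sum>b\<in>UNIV. \<Sum>i\<in>UNIV.
           X $ a $ b * trace (all_but i \<Omega> ** on_site i (?U a b) ** \<rho>))"
      by (subst site, subst sum.swap, rule sum.cong[OF refl], rule sum.swap)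
    then show ?thesis
      by (simp add: F_def sum_divide_distrib sum_distrib_left)
  qed
  have res: "resultant_state \<Omega> \<rho> \<sigma> \<longleftrightarrow> (\<forall>X. trace (\<sigma> ** X) = F X)" for \<sigma>
    by (simp add: resultant_state_def F_def c_def)
  show ?thesis
  proof (rule ex1I)
    show "resultant_state \<Omega> \<rho> (\<chi> b a. F (?U a b))"
      unfolding res trace_mult_sum by (subst F) simp
  next
    fix \<sigma> assume "resultant_state \<Omega> \<rho> \<sigma>"
    then have "\<sigma> $ b $ a = F (?U a b)" for a b
      unfolding res using trace_mult_ketbra by metis
    then show "\<sigma> = (\<chi> b a. F (?U a b))"
      by (simp add: vec_eq_iff)
  qed
qed

end

theory Submission
  imports Defs
begin

text \<open>
  Conjugating with the controlled phases that do not touch \<open>k\<close> shows that \<open>Q_op E \<theta> A k\<close> is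
  \<open>U ** on_site k (proj plus_ket) ** U*\<close> with \<open>U\<close> the product of all controlled phases, whichever
  independent set \<open>A\<close> contains \<open>k\<close>.  Hence the orthonormal basis \<open>U\<close> applied to the Hadamard basis
  diagonalises the test operator: a basis vector whose string \<open>s\<close> has a minus at \<open>k \<in> A\<close> costs the
  factor \<open>1 - 1 / h k\<close> in the term of \<open>A\<close>, so the eigenvalue is 1 at the graph state and at most
  \<open>1 - \<nu>\<close> elsewhere, where \<open>\<nu> = 1 / (m * Max (range h))\<close>.

  For such an operator only the diagonal of \<open>\<rho>\<close> in the tensor basis enters the sampling test, and the
  bound \<open>N \<nu> p (1 - F) \<le> 1 - p\<close> on the fidelity \<open>F\<close> reduces to a scalar inequality for each basis
  vector.  If \<open>r\<close> of the \<open>N + 1\<close> factors differ from the target, this inequality is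
  \<open>(1 + (r - 1) \<nu>) (1 - \<nu>)^(r - 1) \<le> 1\<close>, a consequence of Bernoulli's inequality.
\<close>

section \<open>Operators diagonal in an orthonormal basis\<close>

text \<open>The index type is the type of basis labels itself, so such a family has as many members
  as the dimension and is a basis.\<close>

definition orthonormal_family :: "('a::finite \<Rightarrow> 'a ket) \<Rightarrow> bool" where
  "orthonormal_family b \<longleftrightarrow> (\<forall>s t. braket (b s) (b t) = of_bool (s = t))"

section \<open>Linearity rules and the calculus of rank-one operators\<close>

lemma mult_sum_right: "(A :: 'a::finite oper) ** (\<Sum>x\<in>X. B x) = (\<Sum>x\<in>X. A ** B x)"
  by (induction X rule: infinite_finite_induct) (simp_all add: matrix_add_ldistrib)

lemma mult_sum_left: "(\<Sum>x\<in>X. B x) ** (A :: 'a::finite oper) = (\<Sum>x\<in>X. B x ** A)"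
  by (induction X rule: infinite_finite_induct) (simp_all add: matrix_matrix_mult_def vec_eq_iff sum.distrib distrib_right)

lemma sum_vector_mult: "(\<Sum>x\<in>X. B x) *v (v :: 'a::finite ket) = (\<Sum>x\<in>X. B x *v v)"
  by (induction X rule: infinite_finite_induct) (simp_all add: matrix_vector_mult_add_rdistrib)

lemma scaleR_mult_left: "(r *\<^sub>R A) ** (B :: 'a::finite oper) = r *\<^sub>R (A ** B)"
  by (simp add: vec_eq_iff matrix_matrix_mult_def scaleR_sum_right)

lemma scaleR_vector_mult: "(r *\<^sub>R A) *v (v :: 'a::finite ket) = r *\<^sub>R (A *v v)"
  by (simp add: vec_eq_iff matrix_vector_mult_def scaleR_sum_right)

lemma vector_mult_scaleR: "A *v (r *\<^sub>R v :: 'a::finite ket) = r *\<^sub>R (A *v v)"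
  by (simp add: vec_eq_iff matrix_vector_mult_def scaleR_sum_right)

lemma trace_sum: "trace (\<Sum>x\<in>X. A x :: 'a::finite oper) = (\<Sum>x\<in>X. trace (A x))"
  by (induction X rule: infinite_finite_induct) (simp_all add: trace_def sum.distrib)

lemma trace_scaleR: "trace (r *\<^sub>R A :: 'a::finite oper) = r *\<^sub>R trace A"
  by (simp add: trace_def scaleR_sum_right)

lemma mult_ketbra: "A ** ketbra u v = ketbra (A *v u) v"
  by (simp add: vec_eq_iff ketbra_def matrix_matrix_mult_def matrix_vector_mult_def
      sum_distrib_right mult.assoc)

lemma ketbra_scaleR_left: "ketbra (r *\<^sub>R u) v = r *\<^sub>R ketbra u v"
  by (simp add: vec_eq_iff ketbra_def)

lemma trace_ketbra: "trace (ketbra u v) = braket v u"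
  by (simp add: trace_def ketbra_def braket_def mult.commute)

lemma trace_mult_proj: "trace (A ** proj u) = braket u (A *v u)"
  by (simp add: mult_ketbra trace_ketbra)

lemma trace_proj_mult: "trace (proj u ** A) = braket u (A *v u)"
  by (metis trace_mul_sym trace_mult_proj)

lemma proj_mult_vec: "proj u *v v = braket u v *s u"
  by (simp add: vec_eq_iff ketbra_def matrix_vector_mult_def braket_def sum_distrib_right
      sum_distrib_left ac_simps)

lemma braket_scale_right: "braket u (c *s v) = c * braket u v"
  by (simp add: braket_def sum_distrib_left ac_simps)

text \<open>Orthonormality says that the square matrix with columns \<open>b s\<close> has its
  conjugate transpose as left inverse. A left inverse of a square matrix is also a right inverse,
  and that product is the sum of projections.\<close>

lemma orthonormal_complete:
  assumes "orthonormal_family b"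
  shows "(\<Sum>s\<in>UNIV. proj (b s)) = mat 1"
proof -
  define W where "W = (\<chi> x s. b s $ x)"
  define W' where "W' = (\<chi> s x. cnj (b s $ x))"
  have "W' ** W = mat 1"
    using assms
    by (simp add: W_def W'_def orthonormal_family_def braket_def vec_eq_iff matrix_matrix_mult_def
        mat_def)
  then have "W ** W' = mat 1"
    by (rule matrix_left_right_inverse[THEN iffD1])
  moreover have "W ** W' = (\<Sum>s\<in>UNIV. proj (b s))"
    by (simp add: W_def W'_def vec_eq_iff matrix_matrix_mult_def ketbra_def)
  ultimately show ?thesis by simp
qed

lemma eigenbasis_expansion:
  assumes "orthonormal_family b" and "\<And>s. A *v b s = \<mu> s *\<^sub>R b s"
  shows "A = (\<Sum>s\<in>UNIV. \<mu> s *\<^sub>R proj (b s))"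
proof -
  have "A = A ** (\<Sum>s\<in>UNIV. proj (b s))"
    by (simp add: orthonormal_complete[OF assms(1)])
  also have "\<dots> = (\<Sum>s\<in>UNIV. \<mu> s *\<^sub>R proj (b s))"
    by (simp add: mult_sum_right mult_ketbra assms(2) ketbra_scaleR_left)
  finally show ?thesis .
qed

section \<open>Tensor products\<close>

lemma prod_sum_UNIV:
  fixes f :: "'i::finite \<Rightarrow> 'a::finite \<Rightarrow> 'c::comm_semiring_1"
  shows "(\<Prod>i\<in>UNIV. \<Sum>a\<in>UNIV. f i a) = (\<Sum>x\<in>UNIV. \<Prod>i\<in>UNIV. f i (x i))"
  by (simp add: prod_sum_PiE PiE_UNIV_domain)

lemma prod_of_bool_eq:
  "(\<Prod>i\<in>UNIV. of_bool (P i) :: 'c::comm_semiring_1) = of_bool (\<forall>i::'i::finite. P i)"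
proof (cases "\<forall>i. P i")
  case False
  then obtain i where "\<not> P i" by blast
  then have "(\<Prod>i\<in>UNIV. of_bool (P i) :: 'c) = 0"
    by (intro prod_zero) auto
  with False show ?thesis by simp
qed simp

lemma tensor_op_mult: "tensor_op M ** tensor_op M' = tensor_op (\<lambda>i. M i ** M' i)"
  by (simp add: vec_eq_iff tensor_op_def matrix_matrix_mult_def prod_sum_UNIV prod.distrib)

lemma braket_tensor_ket: "braket (tensor_ket u) (tensor_ket v) = (\<Prod>i\<in>UNIV. braket (u i) (v i))"
  by (simp add: tensor_ket_def braket_def prod_sum_UNIV prod.distrib)

text \<open>Multiplying out the tensor product picks one projection per site. The coefficients may
  vary with the site, which lets one copy be treated differently from the others.\<close>

lemma tensor_op_sum_proj:
  fixes f :: "'i::finite \<Rightarrow> 'a::finite \<Rightarrow> real"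
  shows "tensor_op (\<lambda>i. \<Sum>a\<in>UNIV. f i a *\<^sub>R proj (b a))
    = (\<Sum>x\<in>UNIV. (\<Prod>i\<in>UNIV. f i (x i)) *\<^sub>R proj (tensor_ket (\<lambda>i. b (x i))))"
proof -
  have "(r *\<^sub>R z) = of_real r * z" for r :: real and z :: complex
    by (simp add: scaleR_conv_of_real)
  then show ?thesis
    by (simp add: vec_eq_iff tensor_op_def ketbra_def tensor_ket_def prod_sum_UNIV prod.distrib)
qed

lemma orthonormal_tensor:
  assumes "orthonormal_family b"
  shows "orthonormal_family (\<lambda>x :: 'i::finite \<Rightarrow> 'a::finite. tensor_ket (\<lambda>i. b (x i)))"
  using assms by (simp add: orthonormal_family_def braket_tensor_ket prod_of_bool_eq fun_eq_iff)

section \<open>Random sampling\<close>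

lemma all_but_on_site:
  "all_but i \<Omega> ** on_site i X = tensor_op (\<lambda>j. if j = i then X else \<Omega>)"
  unfolding all_but_def on_site_def tensor_op_mult by (rule arg_cong[where f = tensor_op]) auto

text \<open>This is the contribution of one tensor basis vector to the fidelity bound:
  \<open>i\<close> is the copy left out, the product is the chance that the other copies pass, and
  the extra \<open>real N * \<nu>\<close> is charged when the copy left out is not the
  target.\<close>

lemma sampling_weight_bound:
  fixes \<mu> :: "'a \<Rightarrow> real" and x :: "'c::finite \<Rightarrow> 'a"
  assumes card: "CARD('c) = N + 1"
    and \<nu>: "0 \<le> \<nu>" "\<nu> \<le> 1"
    and one: "\<mu> a0 = 1"
    and gap: "\<And>a. a \<noteq> a0 \<Longrightarrow> 0 \<le> \<mu> a \<and> \<mu> a \<le> 1 - \<nu>"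
  shows "(\<Sum>i\<in>UNIV. (1 + real N * \<nu> * of_bool (x i \<noteq> a0)) * (\<Prod>j\<in>UNIV - {i}. \<mu> (x j)))
    \<le> real N + 1"
proof -
  define S where "S = {i. x i \<noteq> a0}"
  define k where "k = card S"
  have kN: "k \<le> N + 1"
    unfolding k_def card[symmetric] by (rule card_mono) auto
  have cardc: "real (card (- S)) = real N + 1 - real k"
    using kN by (simp add: k_def Compl_eq_Diff_UNIV card_Diff_subset card of_nat_diff)
  have prod: "(\<Prod>j\<in>UNIV - {i}. \<mu> (x j)) \<le> (1 - \<nu>) ^ card (S - {i})" for i
  proof -
    have "(\<Prod>j\<in>UNIV - {i}. \<mu> (x j)) = (\<Prod>j\<in>S - {i}. \<mu> (x j))"
      using one by (intro prod.mono_neutral_right) (auto simp: S_def)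
    also have "\<dots> \<le> (\<Prod>j\<in>S - {i}. 1 - \<nu>)"
      by (rule prod_mono) (auto simp: S_def gap)
    finally show ?thesis by simp
  qed
  have "(\<Sum>i\<in>UNIV. (1 + real N * \<nu> * of_bool (x i \<noteq> a0)) * (\<Prod>j\<in>UNIV - {i}. \<mu> (x j)))
    \<le> (\<Sum>i\<in>UNIV. (1 + real N * \<nu> * of_bool (x i \<noteq> a0)) * (1 - \<nu>) ^ card (S - {i}))"
    by (intro sum_mono mult_left_mono prod) (simp add: \<nu>)
  \<comment> \<open>Leaving out a copy in \<open>S\<close> removes one of the \<open>k\<close> small
    factors; any other choice keeps all of them.\<close>
  also have "\<dots> = (\<Sum>i\<in>UNIV. if i \<in> S then (1 + real N * \<nu>) * (1 - \<nu>) ^ (k - 1) else (1 - \<nu>) ^ k)"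
    by (rule sum.cong) (auto simp: S_def k_def)
  also have "\<dots> = k * ((1 + real N * \<nu>) * (1 - \<nu>) ^ (k - 1)) + (real N + 1 - k) * (1 - \<nu>) ^ k"
    by (simp add: sum.If_cases k_def[symmetric] cardc)
  also have "\<dots> \<le> real N + 1"
  \<comment> \<open>For \<open>k = 0\<close> the left side is exactly \<open>real N + 1\<close>, the
    truncated \<open>k - 1\<close> being multiplied by zero. Otherwise \<open>real N + 1\<close>
    factors out, and Bernoulli leads to a power of \<open>1 - \<nu>\<^sup>2\<close>.\<close>
  proof (cases k)
    case (Suc d)
    have "k * ((1 + real N * \<nu>) * (1 - \<nu>) ^ (k - 1)) + (real N + 1 - k) * (1 - \<nu>) ^ k
      = (real N + 1) * ((1 + d * \<nu>) * (1 - \<nu>) ^ d)"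
      by (simp add: Suc algebra_simps)
    also have "(1 + d * \<nu>) * (1 - \<nu>) ^ d \<le> (1 + \<nu>) ^ d * (1 - \<nu>) ^ d"
      using \<nu> by (intro mult_right_mono Bernoulli_inequality) auto
    also have "\<dots> = (1 - \<nu>\<^sup>2) ^ d"
      by (simp add: power_mult_distrib[symmetric] algebra_simps power2_eq_square)
    also have "\<dots> \<le> 1"
      using \<nu> by (intro power_le_one) (auto simp: power_le_one)
    finally show ?thesis by (simp add: mult_left_mono)
  qed simp
  finally show ?thesis .
qed

text \<open>The sampling argument sees the test only through its spectrum: eigenvalue 1 at
  \<open>a0\<close> and a gap \<open>\<nu>\<close> below it. Graphs enter only when the locale is
  interpreted.\<close>

locale gapped_test =
  fixes b :: "'a::finite \<Rightarrow> 'a ket" and \<Omega> :: "'a oper" and \<mu> :: "'a \<Rightarrow> real" and a0 :: 'a and \<nu> :: real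
  assumes orthonormal: "orthonormal_family b"
    and eigen: "\<And>a. \<Omega> *v b a = \<mu> a *\<^sub>R b a"
    and one: "\<mu> a0 = 1"
    and gap: "\<And>a. a \<noteq> a0 \<Longrightarrow> 0 \<le> \<mu> a \<and> \<mu> a \<le> 1 - \<nu>"
    and nu: "0 < \<nu>" "\<nu> \<le> 1"
begin

text \<open>For a state \<open>\<rho>\<close> these numbers form the outcome distribution of a
  measurement in the tensor basis.\<close>

definition weight :: "('c::finite \<Rightarrow> 'a) oper \<Rightarrow> ('c \<Rightarrow> 'a) \<Rightarrow> real" where
  "weight \<rho> x = Re (braket (tensor_ket (\<lambda>i. b (x i))) (\<rho> *v tensor_ket (\<lambda>i. b (x i))))"

lemma weight_nonneg: "density_op \<rho> \<Longrightarrow> 0 \<le> weight \<rho> x"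
  by (simp add: weight_def density_op_def positive_op_def)

text \<open>The operator is diagonal in the tensor basis, so the off-diagonal part of
  \<open>\<rho>\<close> drops out of the trace.\<close>

lemma trace_tensor:
  fixes f :: "'c::finite \<Rightarrow> 'a \<Rightarrow> real"
  shows "Re (trace (tensor_op (\<lambda>i. \<Sum>a\<in>UNIV. f i a *\<^sub>R proj (b a)) ** \<rho>))
    = (\<Sum>x\<in>UNIV. (\<Prod>i\<in>UNIV. f i (x i)) * weight \<rho> x)"
  by (simp add: tensor_op_sum_proj mult_sum_left scaleR_mult_left trace_sum trace_scaleR
      trace_proj_mult weight_def)

lemma weight_sum:
  fixes \<rho> :: "('c::finite \<Rightarrow> 'a) oper"
  assumes "density_op \<rho>"
  shows "(\<Sum>x\<in>UNIV. weight \<rho> x) = 1"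
proof -
  have "(\<Sum>x\<in>UNIV. weight \<rho> x) = Re (trace ((\<Sum>x\<in>UNIV. proj (tensor_ket (\<lambda>i. b (x i)))) ** \<rho>))"
    by (simp add: mult_sum_left trace_sum trace_proj_mult weight_def)
  then show ?thesis
    using assms by (simp add: orthonormal_complete[OF orthonormal_tensor[OF orthonormal]] density_op_def)
qed

lemma prod_if_site:
  "(\<Prod>j\<in>UNIV. if j = i then f j else g j :: real) = f i * (\<Prod>j\<in>UNIV - {i :: 'c::finite}. g j)"
  by (subst prod.remove[of _ i]) (auto intro!: prod.cong)

text \<open>Both \<open>X\<close> and \<open>\<Omega>\<close> are spectral sums over the same basis.
  With \<open>g\<close> constantly 1 this computes passing probabilities, with \<open>g\<close> the
  indicator of \<open>a0\<close> fidelities.\<close>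

lemma trace_site:
  fixes \<rho> :: "('c::finite \<Rightarrow> 'a) oper"
  assumes "X = (\<Sum>a\<in>UNIV. g a *\<^sub>R proj (b a))"
  shows "Re (trace (tensor_op (\<lambda>j. if j = i then X else \<Omega>) ** \<rho>))
    = (\<Sum>x\<in>UNIV. g (x i) * (\<Prod>j\<in>UNIV - {i}. \<mu> (x j)) * weight \<rho> x)"
proof -
  have "(\<lambda>j. if j = i then X else \<Omega>)
      = (\<lambda>j. \<Sum>a\<in>UNIV. (if j = i then g a else \<mu> a) *\<^sub>R proj (b a))"
    using eigenbasis_expansion[OF orthonormal eigen] assms by auto
  then show ?thesis
    by (simp only: trace_tensor) (simp only: prod_if_site)
qed

lemma pass_prob_expand:
  fixes \<rho> :: "('c::finite \<Rightarrow> 'a) oper"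
  shows "pass_prob \<Omega> \<rho> * real CARD('c)
    = (\<Sum>i\<in>UNIV. \<Sum>x\<in>UNIV. (\<Prod>j\<in>UNIV - {i}. \<mu> (x j)) * weight \<rho> x)"
proof -
  have "mat 1 = (\<Sum>a\<in>UNIV. 1 *\<^sub>R proj (b a))"
    by (simp add: orthonormal_complete[OF orthonormal])
  then show ?thesis
    by (simp add: pass_prob_def all_but_def trace_site[where g = "\<lambda>_. 1"])
qed

text \<open>The weights of the target are the point mass at the constant function \<open>a0\<close>,
  where every factor \<open>\<mu>\<close> equals 1.\<close>

lemma target_passes: "pass_prob \<Omega> (proj (tensor_ket (\<lambda>_ :: 'c::finite. b a0))) = 1"
proof -
  let ?\<rho> = "proj (tensor_ket (\<lambda>_ :: 'c. b a0))"
  have w: "weight ?\<rho> x = of_bool (x = (\<lambda>_. a0))" for x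
    using orthonormal_tensor[OF orthonormal, where 'i = 'c]
    by (simp add: weight_def proj_mult_vec braket_scale_right orthonormal_family_def)
  have "pass_prob \<Omega> ?\<rho> * real CARD('c) = (\<Sum>i\<in>(UNIV :: 'c set). \<Sum>x\<in>UNIV. if x = (\<lambda>_ :: 'c. a0) then 1 else 0)"
    unfolding pass_prob_expand w by (intro sum.cong refl) (auto simp: one)
  also have "\<dots> = real CARD('c)" by simp
  finally have "pass_prob \<Omega> ?\<rho> * real CARD('c) = real CARD('c)" .
  then show ?thesis by simp
qed

text \<open>Averaging the bound for single basis vectors over the distribution
  \<open>weight \<rho>\<close> gives \<open>p + real N * \<nu> * (p * (1 - F)) \<le> 1\<close>; the
  rest is monotonicity in \<open>p\<close>.\<close>

lemma fidelity_bound: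
  fixes \<rho> :: "('c::finite \<Rightarrow> 'a) oper"
  assumes card: "CARD('c) = N + 1" and N: "N \<ge> 1"
    and \<rho>: "density_op \<rho>" and \<beta>: "0 < \<beta>" "\<beta> \<le> pass_prob \<Omega> \<rho>" and \<sigma>: "resultant_state \<Omega> \<rho> \<sigma>"
  shows "Re (braket (b a0) (\<sigma> *v b a0)) \<ge> 1 - (1 - \<beta>) / (\<nu> * real N * \<beta>)"
proof -
  define p where "p = pass_prob \<Omega> \<rho>"
  define F where "F = Re (braket (b a0) (\<sigma> *v b a0))"
  define w where "w = weight \<rho>"
  define q where "q i x = (\<Prod>j\<in>UNIV - {i}. \<mu> (x j))" for i :: 'c and x
  have p0: "p > 0" using \<beta> by (simp add: p_def)
  have p: "p * (real N + 1) = (\<Sum>i\<in>UNIV. \<Sum>x\<in>UNIV. q i x * w x)"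
    using pass_prob_expand[of \<rho>] by (simp add: p_def q_def w_def card add.commute)
  have target: "proj (b a0) = (\<Sum>a\<in>UNIV. of_bool (a = a0) *\<^sub>R proj (b a))"
    by (simp add: of_bool_def if_distrib[of "\<lambda>t. t *\<^sub>R _"] cong: if_cong)
  have "F = Re (trace (\<sigma> ** proj (b a0)))"
    by (simp add: F_def trace_mult_proj)
  also have "trace (\<sigma> ** proj (b a0)) = (\<Sum>i\<in>UNIV. trace (tensor_op (\<lambda>j. if j = i then proj (b a0) else \<Omega>) ** \<rho>))
      / complex_of_real (p * (real N + 1))"
    using \<sigma> by (simp add: resultant_state_def all_but_on_site p_def card)
  also have "Re \<dots> = (\<Sum>i\<in>UNIV. \<Sum>x\<in>UNIV. of_bool (x i = a0) * q i x * w x) / (p * (real N + 1))"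
    by (simp only: Re_divide_of_real Re_sum trace_site[OF target] q_def w_def)
  finally have F: "F * (p * (real N + 1)) = (\<Sum>i\<in>UNIV. \<Sum>x\<in>UNIV. of_bool (x i = a0) * q i x * w x)"
    using p0 by (subst (asm) nonzero_eq_divide_eq) auto
  \<comment> \<open>The difference of the expansions of \<open>p\<close> and \<open>F\<close>
    retains exactly the terms with \<open>x i \<noteq> a0\<close>.\<close>
  have "p * (real N + 1) + real N * \<nu> * (p * (real N + 1) - F * (p * (real N + 1)))
    = (\<Sum>i\<in>UNIV. \<Sum>x\<in>UNIV. (1 + real N * \<nu> * of_bool (x i \<noteq> a0)) * q i x * w x)"
    unfolding F unfolding p sum_subtractf[symmetric] sum_distrib_left sum.distrib[symmetric]
    by (intro sum.cong refl) (auto simp: algebra_simps)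
  also have "\<dots> = (\<Sum>x\<in>UNIV. (\<Sum>i\<in>UNIV. (1 + real N * \<nu> * of_bool (x i \<noteq> a0)) * q i x) * w x)"
    by (subst sum.swap) (simp add: sum_distrib_right)
  also have "\<dots> \<le> (\<Sum>x\<in>UNIV. (real N + 1) * w x)"
    unfolding q_def w_def using nu
    by (intro sum_mono mult_right_mono sampling_weight_bound[OF card] one gap weight_nonneg \<rho>) auto
  also have "\<dots> = real N + 1"
    using weight_sum[OF \<rho>] by (simp add: w_def flip: sum_distrib_left)
  finally have "(real N + 1) * (p + real N * \<nu> * (p * (1 - F))) \<le> (real N + 1) * 1"
    by (simp add: algebra_simps)
  then have "p + real N * \<nu> * (p * (1 - F)) \<le> 1"
    by (subst (asm) mult_le_cancel_left_pos) auto
  then have "1 - F \<le> (1 - p) / (\<nu> * real N * p)"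
    using p0 nu N by (simp add: field_simps)
  \<comment> \<open>In this form the bound visibly decreases in \<open>p\<close>, so
    \<open>p\<close> can be replaced by its lower bound \<open>\<beta>\<close>.\<close>
  also have "\<dots> = (1 / p - 1) / (\<nu> * real N)"
    using p0 by (simp add: field_simps)
  also have "\<dots> \<le> (1 / \<beta> - 1) / (\<nu> * real N)"
    using \<beta> nu by (intro divide_right_mono diff_right_mono) (auto simp: p_def frac_le)
  also have "\<dots> = (1 - \<beta>) / (\<nu> * real N * \<beta>)"
    using \<beta> by (simp add: field_simps)
  finally show ?thesis by (simp add: F_def)
qed

end

section \<open>The graph state basis\<close>

definition diag_op :: "('a::finite \<Rightarrow> complex) \<Rightarrow> 'a oper" where
  "diag_op d = (\<chi> x y. if x = y then d x else 0)"

lemma diag_op_mult: "diag_op d ** diag_op d' = diag_op (\<lambda>x. d x * d' x)"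
  by (auto simp: vec_eq_iff diag_op_def matrix_matrix_mult_def if_distrib[of "\<lambda>t. t * _"] cong: if_cong)

lemma diag_op_add: "diag_op d + diag_op d' = diag_op (\<lambda>x. d x + d' x)"
  by (simp add: vec_eq_iff diag_op_def)

lemma diag_op_vec: "diag_op d *v v = (\<chi> x. d x * v $ x)"
  by (simp add: vec_eq_iff diag_op_def matrix_vector_mult_def if_distrib[of "\<lambda>t. t * _"] cong: if_cong)

lemma on_site_diag_op: "on_site i (diag_op d) = diag_op (\<lambda>x. d (x i))"
proof -
  have "(\<Prod>j\<in>UNIV. (if j = i then diag_op d else mat 1) $ x j $ y j) = diag_op (\<lambda>x. d (x i)) $ x $ y" for x y
  proof -
    have "(\<Prod>j\<in>UNIV. (if j = i then diag_op d else mat 1) $ x j $ y j)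
      = (\<Prod>j\<in>UNIV. of_bool (x j = y j) * (if j = i then d (x i) else 1))"
      by (rule prod.cong) (auto simp: diag_op_def mat_def)
    also have "\<dots> = diag_op (\<lambda>x. d (x i)) $ x $ y"
      by (simp add: prod.distrib prod_of_bool_eq diag_op_def fun_eq_iff)
    finally show ?thesis .
  qed
  then show ?thesis by (simp add: vec_eq_iff on_site_def tensor_op_def)
qed

lemma op_prod_diag:
  "op_prod (map (\<lambda>e. diag_op (d e)) es) = diag_op (\<lambda>x. \<Prod>e\<leftarrow>es. d e x)"
proof (induction es)
  case Nil
  show ?case by (simp add: diag_op_def mat_def)
qed (simp add: diag_op_mult)

text \<open>A common eigenvector passes through the factors one at a time, so no commutation
  argument is required.\<close>

lemma op_prod_eigen:
  assumes "\<And>k. k \<in> set ks \<Longrightarrow> M k *v v = c k *\<^sub>R v"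
  shows "op_prod (map M ks) *v v = (\<Prod>k\<leftarrow>ks. c k) *\<^sub>R v"
  using assms by (induction ks) (simp_all add: matrix_vector_mul_assoc[symmetric] vector_mult_scaleR mult.commute)

lemma controlled_phase_diag:
  "controlled_phase j k t = diag_op (\<lambda>x. if x j \<and> x k then cis t else 1)"
proof -
  have "proj (ket False) = diag_op (\<lambda>a. of_bool (\<not> a))"
    and "proj (ket True) = diag_op of_bool"
    and "proj (ket False) + ketbra (cis t *s ket True) (ket True) = diag_op (\<lambda>a. if a then cis t else 1)"
    by (auto simp: vec_eq_iff ketbra_def ket_def axis_def diag_op_def)
  then show ?thesis
    unfolding controlled_phase_def
    by (simp only: on_site_diag_op diag_op_mult diag_op_add) (rule arg_cong[where f = diag_op], auto)
qed

text \<open>The product of all controlled phases multiplies the basis vector labelled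
  \<open>x\<close> by \<open>cis\<close> of this angle.\<close>

definition graph_phase :: "('v \<times> 'v) set \<Rightarrow> ('v \<Rightarrow> 'v \<Rightarrow> real) \<Rightarrow> ('v \<Rightarrow> bool) \<Rightarrow> real" where
  "graph_phase E \<theta> x = (\<Sum>(j, k)\<in>E. \<theta> j k * of_bool (x j \<and> x k))"

text \<open>In coordinates, this is the product of all controlled phases applied to the Hadamard
  basis vector that has a minus exactly where \<open>s\<close> holds.\<close>

definition graph_basis ::
  "('v::finite \<times> 'v) set \<Rightarrow> ('v \<Rightarrow> 'v \<Rightarrow> real) \<Rightarrow> ('v \<Rightarrow> bool) \<Rightarrow> ('v \<Rightarrow> bool) ket" where
  "graph_basis E \<theta> s =
     (\<chi> x. cis (graph_phase E \<theta> x) * (\<Prod>v\<in>UNIV. (if s v \<and> x v then - 1 else 1) / complex_of_real (sqrt 2)))"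

lemma prod_cis: "(\<Prod>x\<in>X. cis (f x)) = cis (\<Sum>x\<in>X. f x)"
  by (induction X rule: infinite_finite_induct) (simp_all add: cis_mult)

lemma set_edge_list [simp]: "set (edge_list E) = E"
  by (auto simp: edge_list_def)

lemma distinct_edge_list [simp]: "distinct (edge_list E)"
  by (simp add: edge_list_def distinct_product)

lemma plus_ket_nth: "plus_ket $ c = 1 / complex_of_real (sqrt 2)"
  by (cases c) (simp_all add: plus_ket_def ket_def axis_def scaleR_conv_of_real[where 'a = complex] of_real_divide)

lemma graph_state_eq_basis: "graph_state E \<theta> = graph_basis E \<theta> (\<lambda>_. False)"
proof -
  define d where "d e x = (if x (fst e) \<and> x (snd e) then cis (\<theta> (fst e) (snd e)) else 1)" for e x
  have "(\<lambda>(j, k). controlled_phase j k (\<theta> j k)) = (\<lambda>e. diag_op (d e))"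
    by (auto simp: fun_eq_iff controlled_phase_diag d_def intro!: arg_cong[where f = diag_op])
  then have "op_prod (map (\<lambda>(j, k). controlled_phase j k (\<theta> j k)) (edge_list E))
      = diag_op (\<lambda>x. \<Prod>e\<leftarrow>edge_list E. d e x)"
    by (simp add: op_prod_diag)
  also have "\<dots> = diag_op (\<lambda>x. \<Prod>e\<in>E. d e x)"
    by (simp add: prod.distinct_set_conv_list[symmetric])
  also have "(\<lambda>x. \<Prod>e\<in>E. d e x) = (\<lambda>x. cis (graph_phase E \<theta> x))"
    unfolding graph_phase_def prod_cis[symmetric] by (intro ext prod.cong) (auto simp: d_def)
  finally show ?thesis
    by (simp add: graph_state_def diag_op_vec graph_basis_def tensor_ket_def plus_ket_nth)
qed

text \<open>The phases do not depend on \<open>s\<close> and cancel in the inner product. What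
  remains factorises over the vertices into inner products of the plus and minus states.\<close>

lemma orthonormal_graph_basis: "orthonormal_family (graph_basis E \<theta>)"
proof -
  have "braket (graph_basis E \<theta> s) (graph_basis E \<theta> t) = of_bool (s = t)" for s t
  proof -
    let ?r = "complex_of_real (sqrt 2)"
    let ?g = "\<lambda>v c. ((if s v \<and> c then - 1 else 1) / ?r) * ((if t v \<and> c then - 1 else 1) / ?r)"
    have r: "?r * ?r = 2"
      by (simp flip: of_real_mult)
    have cis: "cnj (cis a) * cis a = 1" for a
      by (simp add: cis_cnj cis_mult)
    have "cnj (graph_basis E \<theta> s $ x) * graph_basis E \<theta> t $ x = (\<Prod>v\<in>UNIV. ?g v (x v))" for x
    proof -
      have "cnj (graph_basis E \<theta> s $ x) * graph_basis E \<theta> t $ x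
        = (cnj (cis (graph_phase E \<theta> x)) * cis (graph_phase E \<theta> x)) *
          (cnj (\<Prod>v\<in>UNIV. (if s v \<and> x v then - 1 else 1) / ?r) * (\<Prod>v\<in>UNIV. (if t v \<and> x v then - 1 else 1) / ?r))"
        by (simp add: graph_basis_def mult_ac)
      also have "\<dots> = (\<Prod>v\<in>UNIV. ?g v (x v))"
        unfolding cis cnj_prod prod.distrib[symmetric] by (auto intro!: prod.cong)
      finally show ?thesis .
    qed
    then have "braket (graph_basis E \<theta> s) (graph_basis E \<theta> t) = (\<Prod>v\<in>UNIV. \<Sum>c\<in>UNIV. ?g v c)"
      by (simp only: braket_def prod_sum_UNIV)
    also have "\<dots> = (\<Prod>v\<in>UNIV. of_bool (s v = t v))"
      by (rule prod.cong) (auto simp: UNIV_bool r)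
    finally show ?thesis
      by (simp add: prod_of_bool_eq fun_eq_iff)
  qed
  then show ?thesis by (simp add: orthonormal_family_def)
qed

lemma sum_edges:
  fixes E :: "('v::finite \<times> 'v) set"
  shows "(\<Sum>(j, k)\<in>E. f j k) = (\<Sum>j\<in>UNIV. \<Sum>k\<in>UNIV. if (j, k) \<in> E then f j k else 0)"
proof -
  have "(\<Sum>(j, k)\<in>E. f j k) = (\<Sum>e\<in>UNIV. if e \<in> E then case_prod f e else 0)"
    by (simp add: sum.If_cases)
  also have "\<dots> = (\<Sum>j\<in>UNIV. \<Sum>k\<in>UNIV. if (j, k) \<in> E then f j k else 0)"
    by (simp add: sum.cartesian_product case_prod_unfold cong: if_cong)
  finally show ?thesis .
qed

text \<open>Only edges at \<open>k\<close> feel the bit at \<open>k\<close>, and by independence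
  their other endpoints lie outside \<open>A\<close>. Hence the change of phase is the angle used in
  the test, which does not read \<open>x k\<close>.\<close>

lemma graph_phase_update:
  assumes G: "weighted_graph E \<theta>" and A: "independent_vertices E A" "k \<in> A"
  shows "graph_phase E \<theta> (x(k := c))
    = graph_phase E \<theta> (x(k := False)) + of_bool c * phase_angle E \<theta> A k x"
proof (cases c)
  case True
  have less: "a < b" if "(a, b) \<in> E" for a b
    using G that by (auto simp: weighted_graph_def)
  have sym: "\<theta> a b = \<theta> b a" for a b
    using G by (simp add: weighted_graph_def)
  define f where "f j = \<theta> j k * of_bool (x j)" for j
  \<comment> \<open>The change is split by which endpoint of the edge is \<open>k\<close>; edges run
    upwards, so there are no loops and never both.\<close>
  have "graph_phase E \<theta> (x(k := True)) - graph_phase E \<theta> (x(k := False))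
    = (\<Sum>(a, b)\<in>E. (if a = k then f b else 0) + (if b = k then f a else 0))"
    unfolding graph_phase_def sum_subtractf[symmetric]
  proof (intro sum.cong refl, clarify)
    fix a b assume "(a, b) \<in> E"
    then have "a \<noteq> b" using less by blast
    then show "\<theta> a b * of_bool ((x(k := True)) a \<and> (x(k := True)) b)
        - \<theta> a b * of_bool ((x(k := False)) a \<and> (x(k := False)) b)
      = (if a = k then f b else 0) + (if b = k then f a else 0)"
      by (cases "a = k"; cases "b = k") (simp_all add: f_def sym[of k b])
  qed
  also have "\<dots> = (\<Sum>a\<in>UNIV. \<Sum>b\<in>UNIV. (if a = k then if (k, b) \<in> E then f b else 0 else 0))
      + (\<Sum>a\<in>UNIV. \<Sum>b\<in>UNIV. (if b = k then if (a, k) \<in> E then f a else 0 else 0))"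
    unfolding sum_edges sum.distrib[symmetric] by (intro sum.cong refl) auto
  also have "\<dots> = (\<Sum>j\<in>UNIV. (if (k, j) \<in> E then f j else 0) + (if (j, k) \<in> E then f j else 0))"
    by (subst sum.swap) (simp add: sum.distrib)
  \<comment> \<open>Since edges run upwards, at most one of the two orientations is present, so no
    neighbour is counted twice.\<close>
  also have "\<dots> = (\<Sum>j\<in>UNIV. if j \<in> - A \<and> adjacent E j k then f j else 0)"
    using A by (intro sum.cong refl) (auto simp: independent_vertices_def adjacent_def dest: less less_asym[OF less])
  also have "\<dots> = phase_angle E \<theta> A k x"
    by (simp add: phase_angle_def f_def sum.If_cases)
  finally show ?thesis using True by simp
qed simp

lemma phase_ket_nth: "phase_ket \<alpha> $ c = cis (of_bool c * \<alpha>) / complex_of_real (sqrt 2)"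
  by (cases c) (simp_all add: phase_ket_def ket_def axis_def scaleR_conv_of_real[where 'a = complex] of_real_divide)

text \<open>As a function of the bit at \<open>k\<close> alone, a basis vector is a multiple of the
  phase ket or, if \<open>s k\<close>, of its orthogonal partner. The scalar \<open>R\<close>
  absorbs everything independent of that bit.\<close>

lemma graph_basis_update:
  assumes "weighted_graph E \<theta>" and "independent_vertices E A" and "k \<in> A"
  obtains R where "\<And>c. graph_basis E \<theta> s $ (x(k := c))
    = R * phase_ket (phase_angle E \<theta> A k x) $ c * (if s k \<and> c then - 1 else 1)"
proof
  fix c
  have "(\<Prod>v\<in>UNIV. (if s v \<and> (x(k := c)) v then - 1 else 1) / complex_of_real (sqrt 2))
    = (if s k \<and> c then - 1 else 1) / complex_of_real (sqrt 2)
      * (\<Prod>v\<in>UNIV - {k}. (if s v \<and> x v then - 1 else 1) / complex_of_real (sqrt 2))"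
    by (subst prod.remove[of _ k]) (auto intro!: prod.cong)
  then show "graph_basis E \<theta> s $ (x(k := c))
    = (cis (graph_phase E \<theta> (x(k := False)))
        * (\<Prod>v\<in>UNIV - {k}. (if s v \<and> x v then - 1 else 1) / complex_of_real (sqrt 2)))
      * phase_ket (phase_angle E \<theta> A k x) $ c * (if s k \<and> c then - 1 else 1)"
    unfolding graph_basis_def vec_lambda_beta graph_phase_update[OF assms, of x c] cis_mult[symmetric] phase_ket_nth
    by (simp add: mult_ac)
qed

section \<open>Spectrum of the test operator\<close>

text \<open>Of the sum over bit strings only the term with \<open>z\<close> equal to
  \<open>x\<close> on \<open>- A\<close> survives, and the identity and basis projections force
  \<open>x\<close> and \<open>y\<close> to agree off \<open>k\<close>.\<close>

lemma Q_op_nth: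
  assumes "k \<in> A"
  shows "Q_op E \<theta> A k $ x $ y = (if \<forall>v. v \<noteq> k \<longrightarrow> x v = y v
    then phase_ket (phase_angle E \<theta> A k x) $ x k * cnj (phase_ket (phase_angle E \<theta> A k x) $ y k) else 0)"
proof -
  let ?P = "\<lambda>z. proj (phase_ket (phase_angle E \<theta> A k z)) $ x k $ y k"
  let ?M = "\<lambda>z v. if v = k then proj (phase_ket (phase_angle E \<theta> A k z))
                       else if v \<in> - A then proj (ket (z v)) else mat 1"
  have "(\<Prod>v\<in>UNIV. ?M z v $ x v $ y v)
    = (if z = restrict x (- A) then if \<forall>v. v \<noteq> k \<longrightarrow> x v = y v then ?P z else 0 else 0)"
    if z: "z \<in> (- A) \<rightarrow>\<^sub>E UNIV" for z
  proof -
    \<comment> \<open>Extensionality makes \<open>z\<close> determined by its values on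
      \<open>- A\<close>.\<close>
    have eq: "z = restrict x (- A) \<longleftrightarrow> (\<forall>v\<in>- A. x v = z v)"
      using z by (auto simp: fun_eq_iff PiE_def extensional_def restrict_def)
    have "(\<Prod>v\<in>UNIV. ?M z v $ x v $ y v)
      = (\<Prod>v\<in>UNIV. (if v = k then ?P z else 1)
          * of_bool (v \<noteq> k \<longrightarrow> x v = y v \<and> (v \<in> - A \<longrightarrow> x v = z v)))"
      by (rule prod.cong) (auto simp: mat_def ketbra_def ket_def axis_def)
    also have "\<dots> = ?P z * of_bool (\<forall>v. v \<noteq> k \<longrightarrow> x v = y v \<and> (v \<in> - A \<longrightarrow> x v = z v))"
      by (simp only: prod.distrib prod_of_bool_eq) simp
    also have "(\<forall>v. v \<noteq> k \<longrightarrow> x v = y v \<and> (v \<in> - A \<longrightarrow> x v = z v))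
      \<longleftrightarrow> z = restrict x (- A) \<and> (\<forall>v. v \<noteq> k \<longrightarrow> x v = y v)"
      using assms unfolding eq by auto
    finally show ?thesis by (simp del: restrict_apply)
  qed
  then have "Q_op E \<theta> A k $ x $ y
    = (\<Sum>z\<in>(- A) \<rightarrow>\<^sub>E UNIV. if z = restrict x (- A) then if \<forall>v. v \<noteq> k \<longrightarrow> x v = y v then ?P z else 0 else 0)"
    unfolding Q_op_def tensor_op_def by simp
  also have "\<dots> = (if \<forall>v. v \<noteq> k \<longrightarrow> x v = y v then ?P (restrict x (- A)) else 0)"
    by (subst sum.delta) (auto intro: finite_PiE)
  also have "phase_angle E \<theta> A k (restrict x (- A)) = phase_angle E \<theta> A k x"
    unfolding phase_angle_def by (rule sum.cong) auto
  finally show ?thesis by (simp only: ketbra_def vec_lambda_beta)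
qed

text \<open>With the bits off \<open>k\<close> fixed, \<open>Q_op\<close> projects onto the phase
  ket at \<open>k\<close>. It therefore keeps basis vectors with a plus at \<open>k\<close> and
  annihilates those with a minus.\<close>

lemma Q_op_basis:
  assumes "weighted_graph E \<theta>" and "independent_vertices E A" and "k \<in> A"
  shows "Q_op E \<theta> A k *v graph_basis E \<theta> s = of_bool (\<not> s k) *\<^sub>R graph_basis E \<theta> s"
proof -
  have "(Q_op E \<theta> A k *v graph_basis E \<theta> s) $ x = of_bool (\<not> s k) *\<^sub>R graph_basis E \<theta> s $ x" for x
  proof -
    let ?u = "phase_ket (phase_angle E \<theta> A k x)"
    obtain R where R: "\<And>c. graph_basis E \<theta> s $ (x(k := c)) = R * ?u $ c * (if s k \<and> c then - 1 else 1)"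
      using graph_basis_update[OF assms] by blast
    have u: "cnj (?u $ c) * ?u $ c = 1 / 2" for c
      by (simp add: phase_ket_nth cis_cnj cis_mult flip: of_real_mult)
    have "(Q_op E \<theta> A k *v graph_basis E \<theta> s) $ x
      = (\<Sum>y\<in>UNIV. if \<forall>v. v \<noteq> k \<longrightarrow> x v = y v then ?u $ x k * cnj (?u $ y k) * graph_basis E \<theta> s $ y else 0)"
      unfolding matrix_vector_mult_def vec_lambda_beta Q_op_nth[OF assms(3)] by (intro sum.cong) auto
    \<comment> \<open>The strings that agree with \<open>x\<close> off \<open>k\<close> are the two
      updates of \<open>x\<close> at \<open>k\<close>.\<close>
    also have "\<dots> = (\<Sum>y\<in>range (\<lambda>c. x(k := c)). ?u $ x k * cnj (?u $ y k) * graph_basis E \<theta> s $ y)"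
    proof (rule sum.mono_neutral_cong_right)
      show "\<forall>y\<in>UNIV - range (\<lambda>c. x(k := c)).
        (if \<forall>v. v \<noteq> k \<longrightarrow> x v = y v then ?u $ x k * cnj (?u $ y k) * graph_basis E \<theta> s $ y else 0) = 0"
      proof
        fix y assume "y \<in> UNIV - range (\<lambda>c. x(k := c))"
        then have "y \<noteq> x(k := y k)" by blast
        then obtain v where "y v \<noteq> (x(k := y k)) v" unfolding fun_eq_iff by blast
        then have "\<not> (\<forall>v. v \<noteq> k \<longrightarrow> x v = y v)" by (metis fun_upd_apply)
        then show "(if \<forall>v. v \<noteq> k \<longrightarrow> x v = y v then ?u $ x k * cnj (?u $ y k) * graph_basis E \<theta> s $ y else 0) = 0"
          by (simp only: if_False)
      qed
    qed auto
    also have "\<dots> = (\<Sum>c\<in>UNIV. ?u $ x k * cnj (?u $ c) * graph_basis E \<theta> s $ (x(k := c)))"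
      by (subst sum.reindex) (auto simp: inj_on_def fun_eq_iff split: if_splits)
    also have "\<dots> = (\<Sum>c\<in>UNIV. ?u $ x k * R * (cnj (?u $ c) * ?u $ c) * (if s k \<and> c then - 1 else 1))"
      unfolding R by (simp add: mult_ac)
    \<comment> \<open>Both squared amplitudes are 1/2; the two terms add to 1 for a plus and cancel
      for a minus.\<close>
    also have "\<dots> = of_bool (\<not> s k) *\<^sub>R graph_basis E \<theta> s $ (x(k := x k))"
      unfolding u R by (simp add: UNIV_bool)
    finally show ?thesis by simp
  qed
  then show ?thesis by (simp add: vec_eq_iff)
qed

definition test_eigenvalue :: "'v set set \<Rightarrow> ('v \<Rightarrow> nat) \<Rightarrow> ('v \<Rightarrow> bool) \<Rightarrow> real" where
  "test_eigenvalue \<A> h s = (\<Sum>A\<in>\<A>. \<Prod>k\<in>A. if s k then 1 - 1 / real (h k) else 1) / real (card \<A>)"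

lemma cover_op_basis:
  assumes "weighted_graph E \<theta>" and "independent_vertices E A" and h: "\<And>k. h k > 0"
  shows "cover_op E \<theta> h A *v graph_basis E \<theta> s
    = (\<Prod>k\<in>A. if s k then 1 - 1 / real (h k) else 1) *\<^sub>R graph_basis E \<theta> s"
proof -
  define c where "c k = (if s k then 1 - 1 / real (h k) else 1)" for k
  let ?b = "graph_basis E \<theta> s"
  have factor: "((1 / real (h k)) *\<^sub>R Q_op E \<theta> A k + ((real (h k) - 1) / real (h k)) *\<^sub>R mat 1) *v ?b
    = c k *\<^sub>R ?b" if "k \<in> A" for k
  proof -
    have "((1 / real (h k)) *\<^sub>R Q_op E \<theta> A k + ((real (h k) - 1) / real (h k)) *\<^sub>R mat 1) *v ?b
      = (1 / real (h k) * of_bool (\<not> s k) + (real (h k) - 1) / real (h k)) *\<^sub>R ?b"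
      by (simp only: matrix_vector_mult_add_rdistrib scaleR_vector_mult Q_op_basis[OF assms(1,2) that]
          matrix_vector_mul_lid scaleR_scaleR scaleR_add_left)
    also have "1 / real (h k) * of_bool (\<not> s k) + (real (h k) - 1) / real (h k) = c k"
      using h[of k] by (simp add: c_def field_simps)
    finally show ?thesis .
  qed
  have "cover_op E \<theta> h A *v ?b = (\<Prod>k\<leftarrow>sorted_list_of_set A. c k) *\<^sub>R ?b"
    unfolding cover_op_def by (rule op_prod_eigen) (simp add: factor)
  then show ?thesis
    unfolding c_def[symmetric] by (simp add: prod.distinct_set_conv_list[symmetric])
qed

lemma test_op_basis:
  assumes "weighted_graph E \<theta>" and "independence_cover E \<A>" and "\<And>k. h k > 0"
  shows "test_op E \<theta> \<A> h *v graph_basis E \<theta> s = test_eigenvalue \<A> h s *\<^sub>R graph_basis E \<theta> s"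
proof -
  have "cover_op E \<theta> h A *v graph_basis E \<theta> s
    = (\<Prod>k\<in>A. if s k then 1 - 1 / real (h k) else 1) *\<^sub>R graph_basis E \<theta> s" if "A \<in> \<A>" for A
  proof (rule cover_op_basis)
    show "independent_vertices E A"
      using assms(2) that by (simp add: independence_cover_def)
  qed (fact assms)+
  then have "(\<Sum>A\<in>\<A>. cover_op E \<theta> h A) *v graph_basis E \<theta> s
    = (\<Sum>A\<in>\<A>. \<Prod>k\<in>A. if s k then 1 - 1 / real (h k) else 1) *\<^sub>R graph_basis E \<theta> s"
    unfolding sum_vector_mult scaleR_sum_left by (rule sum.cong[OF refl])
  then show ?thesis
    by (simp only: test_op_def test_eigenvalue_def scaleR_vector_mult scaleR_scaleR)
      (simp only: times_divide_eq_left mult_1)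
qed

text \<open>Some \<open>k\<close> carries a minus, which lowers the term of the cover member
  containing \<open>k\<close> by at least \<open>1 / real (Max (range h))\<close>. All other terms
  are at most 1, and the average over the cover divides the loss by
  \<open>card \<A>\<close>.\<close>

lemma test_eigenvalue_gap:
  fixes \<A> :: "'v::finite set set"
  assumes cover: "\<Union>\<A> = UNIV" and h: "\<And>k. h k > 0" and s: "s \<noteq> (\<lambda>_. False)"
  shows "0 \<le> test_eigenvalue \<A> h s"
    and "test_eigenvalue \<A> h s \<le> 1 - 1 / (real (card \<A>) * real (Max (range h)))"
proof -
  define c where "c k = (if s k then 1 - 1 / real (h k) else 1)" for k
  have c: "0 \<le> c k" "c k \<le> 1" for k
    using h[of k] by (auto simp: c_def)
  show "0 \<le> test_eigenvalue \<A> h s"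
    unfolding test_eigenvalue_def c_def[symmetric] by (intro divide_nonneg_nonneg sum_nonneg prod_nonneg) (auto simp: c)
  obtain k where k: "s k" using s by (auto simp: fun_eq_iff)
  obtain A where A: "A \<in> \<A>" "k \<in> A" using cover by (metis UNIV_I UnionE)
  then have m: "card \<A> > 0" by (auto simp: card_gt_0_iff)
  have "prod c A = c k * prod c (A - {k})"
    using A by (intro prod.remove) auto
  also have "\<dots> \<le> c k"
    using c by (intro mult_right_le_one_le prod_nonneg prod_le_1) auto
  also have "\<dots> \<le> 1 - 1 / real (Max (range h))"
    using h[of k] k by (simp add: c_def frac_le)
  finally have "prod c A \<le> 1 - 1 / real (Max (range h))" .
  moreover have "(\<Sum>A\<in>\<A> - {A}. prod c A) \<le> (\<Sum>A\<in>\<A> - {A}. 1)"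
    by (intro sum_mono prod_le_1) (auto simp: c)
  moreover have "(\<Sum>A\<in>\<A> - {A}. 1 :: real) = real (card \<A>) - 1"
    using A m by (simp add: of_nat_diff)
  ultimately have "(\<Sum>A\<in>\<A>. prod c A) \<le> real (card \<A>) - 1 / real (Max (range h))"
    using A by (simp add: sum.remove[of \<A> A])
  then have "(\<Sum>A\<in>\<A>. prod c A) / real (card \<A>) \<le> (real (card \<A>) - 1 / real (Max (range h))) / real (card \<A>)"
    by (intro divide_right_mono) auto
  then show "test_eigenvalue \<A> h s \<le> 1 - 1 / (real (card \<A>) * real (Max (range h)))"
    using A(1) m unfolding test_eigenvalue_def c_def[symmetric]
    by (auto simp: diff_divide_distrib mult.commute split: if_splits)
qed

theorem theorem3:
  fixes E :: "('v::{finite,linorder} \<times> 'v) set"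
    and \<theta> :: "'v \<Rightarrow> 'v \<Rightarrow> real"
    and \<A> :: "'v set set"
    and h :: "'v \<Rightarrow> nat"
    and N :: nat
    and \<beta> :: real
  assumes "weighted_graph E \<theta>"
    and "independence_cover E \<A>"
    and "\<And>k. h k > 0"
    and "N \<ge> 1"
    and "CARD('c::finite) = N + 1"
    and "0 < \<beta>" and "\<beta> \<le> 1"
  shows "pass_prob (test_op E \<theta> \<A> h)
           (proj (tensor_ket (\<lambda>_ :: 'c. graph_state E \<theta>))) = 1 \<and>
         (\<forall>(\<rho> :: ('c \<Rightarrow> 'v \<Rightarrow> bool) oper) \<sigma>.
           density_op \<rho> \<and> pass_prob (test_op E \<theta> \<A> h) \<rho> \<ge> \<beta> \<and>
           resultant_state (test_op E \<theta> \<A> h) \<rho> \<sigma> \<longrightarrow>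
           Re (braket (graph_state E \<theta>) (\<sigma> *v graph_state E \<theta>))
             \<ge> 1 - real (card \<A>) * (1 - \<beta>) * real (Max (range h)) / (real N * \<beta>))"
proof -
  let ?\<nu> = "1 / (real (card \<A>) * real (Max (range h)))"
  have cover: "\<Union>\<A> = UNIV"
    using assms(2) by (simp add: independence_cover_def partition_on_def)
  then have m: "card \<A> > 0" by (auto simp: card_gt_0_iff)
  have hmax: "Max (range h) > 0"
    using assms(3) by (simp add: Max_gr_iff)
  \<comment> \<open>The label of the graph state is the constant \<open>False\<close>, a string
    without a minus; the inverse of \<open>?\<nu>\<close> supplies the factors
    \<open>card \<A>\<close> and \<open>Max (range h)\<close> of the final bound.\<close>
  interpret gapped_test "graph_basis E \<theta>" "test_op E \<theta> \<A> h" "test_eigenvalue \<A> h" "\<lambda>_. False" ?\<nu>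
  proof
    have "1 \<le> real (card \<A> * Max (range h))"
      using m hmax by (simp only: real_of_nat_ge_one_iff) simp
    then show "?\<nu> \<le> 1" by (simp add: divide_le_eq_1)
    show "0 < ?\<nu>" using m hmax by simp
    show "test_eigenvalue \<A> h (\<lambda>_. False) = 1"
      using m by (auto simp: test_eigenvalue_def)
    show "orthonormal_family (graph_basis E \<theta>)"
      by (rule orthonormal_graph_basis)
    show "test_op E \<theta> \<A> h *v graph_basis E \<theta> s = test_eigenvalue \<A> h s *\<^sub>R graph_basis E \<theta> s" for s
      by (rule test_op_basis[OF assms(1-3)])
    show "0 \<le> test_eigenvalue \<A> h s \<and> test_eigenvalue \<A> h s \<le> 1 - ?\<nu>" if "s \<noteq> (\<lambda>_. False)" for s
      using test_eigenvalue_gap[of \<A> h, OF cover assms(3) that] by blast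
  qed
  have bound: "(1 - \<beta>) / (?\<nu> * real N * \<beta>)
      = real (card \<A>) * (1 - \<beta>) * real (Max (range h)) / (real N * \<beta>)"
    by (simp add: mult_ac)
  show ?thesis
    unfolding graph_state_eq_basis bound[symmetric]
  proof (intro conjI allI impI)
    show "pass_prob (test_op E \<theta> \<A> h) (proj (tensor_ket (\<lambda>_ :: 'c. graph_basis E \<theta> (\<lambda>_. False)))) = 1"
      by (rule target_passes)
  next
    fix \<rho> :: "('c \<Rightarrow> 'v \<Rightarrow> bool) oper" and \<sigma>
    assume "density_op \<rho> \<and> \<beta> \<le> pass_prob (test_op E \<theta> \<A> h) \<rho> \<and> resultant_state (test_op E \<theta> \<A> h) \<rho> \<sigma>"
    then show "1 - (1 - \<beta>) / (?\<nu> * real N * \<beta>)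
        \<le> Re (braket (graph_basis E \<theta> (\<lambda>_. False)) (\<sigma> *v graph_basis E \<theta> (\<lambda>_. False)))"
      using assms(4-6) by (intro fidelity_bound[of N \<rho>]) simp_all
  qed
qed

end
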